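(* Let $P$ be an ergodic Markov kernel on a finite set $\mathcal X$, $n=|\mathcal X|\ge3$, reversible with respect to the strictly positive probability distribution $\pi$, and let $k\in\{2,\ldots,n-1\}$. Let $\eta_1\le\cdots\le\eta_{n-1}$ be the eigenvalues of $P^2$ on $\ell_0^2(\pi)$ with multiplicity and $\phi_1,\ldots,\phi_{n-1}$ the fixed corresponding $\pi$-orthonormal eigenbasis. Let $F_\star$ and $\beta_j^\star$ ($1\le j\le n-1$) be given by either of the following: (i) for an integer $T\ge1$ and weights $w_1,\ldots,w_T\ge0$ not all zero, $F_\star(\mathcal O)=\sum_{t=1}^Tw_t\|G_{\mathcal O}P^t-\Pi\|_{F,\pi}^2$ and $\beta_j^\star=\sum_{t=1}^Tw_t\eta_j^t$; (ii) for $0\le\gamma<1$, $F_\star(\mathcal O)=\sum_{t=1}^\infty\gamma^{t-1}\|G_{\mathcal O}P^t-\Pi\|_{F,\pi}^2$ and $\beta_j^\star=\eta_j/(1-\gamma\eta_j)$. Put $g_\star=\beta_k^\star-\beta_{k-1}^\star$, $W_\star=\beta_{n-1}^\star-\beta_1^\star$, $\delta(\mathcal O)=\sum_{j=1}^{k-1}\|(I-G_{\mathcal O})\phi_j\|_\pi^2$, $F_{\star,k}^*=\min_{|\mathcal O|=k}F_\star(\mathcal O)$ and $\delta_k^*=\min_{|\mathcal O|=k}\delta(\mathcal O)$. Let $\widehat{\mathcal O}_\star$ be the output of the multi-horizon spectral sweep (the algorithm described in the context) for the chosen objective $F_\star$, and let $\mathcal O^{(1)},\ldots,\mathcal O^{(\ell)}$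 be the candidate partitions that it generates. Then $$0\le F_\star(\widehat{\mathcal O}_\star)-F_{\star,k}^*\le W_\star\min_{1\le s\le\ell}\delta(\mathcal O^{(s)})-g_\star\,\delta_k^*.$$ If at least one candidate is a $\rho$-approximation for weighted $k$-means, so that $\min_{1\le s\le\ell}\delta(\mathcal O^{(s)})\le\rho\,\delta_k^*$, then $$F_\star(\widehat{\mathcal O}_\star)-F_{\star,k}^*\le(\rho W_\star-g_\star)\,\delta_k^*.$$
   Context: $\pi(x)>0$ for all $x\in\mathcal X$. $\ell^2(\pi)$ is the space of real functions on $\mathcal X$ with $\langle f,h\rangle_\pi=\sum_x\pi(x)f(x)h(x)$ and norm $\|\cdot\|_\pi$; $\ell^2_0(\pi)=\{f:\sum_x\pi(x)f(x)=0\}$. Kernels act by $(Pf)(x)=\sum_yP(x,y)f(y)$. Ergodic means irreducible and aperiodic; reversible means $\pi(x)P(x,y)=\pi(y)P(y,x)$ for all $x,y$. The eigenbasis $\phi_1,\ldots,\phi_{n-1}$ of $\ell_0^2(\pi)$ satisfies $P^2\phi_j=\eta_j\phi_j$ and is chosen so that each $\phi_j$ is also an eigenfunction of $P$. $\Pi(x,y)=\pi(y)$. The Gibbs kernel of $\mathcal O=\{O_1,\ldots,O_k\}$ is $G_{\mathcal O}(x,y)=\sum_{i=1}^k\mathbf 1_{O_i}(x)\mathbf 1_{O_i}(y)\pi(y)/\pi(O_i)$. For an operator $A$ on $\ell^2(\pi)$, $\|A\|_{F,\pi}^2=\operatorname{Tr}(A^*A)=\sum_{x,y}\frac{\pi(x)}{\pi(y)}A(x,y)^2$.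 When $\gamma=0$, $\gamma^{0}$ is read as $1$. Minima over $|\mathcal O|=k$ range over all partitions of $\mathcal X$ into $k$ nonempty blocks. Multi-horizon spectral sweep: (1) Compute $\phi_1,\ldots,\phi_{k-1}$ from the bottom spectral subspace of $P^2$ and form the embedding $\Phi(x)=(\phi_1(x),\ldots,\phi_{k-1}(x))\in\mathbb R^{k-1}$. (2) Spectral rounding: approximately minimize $\delta(\mathcal O)$ by running weighted $k$-means on the embedded points $\Phi(x)$, with weights $\pi(x)$, from several initializations; the weighted $k$-means distortion $\sum_{i=1}^k\sum_{x\in O_i}\pi(x)\|\Phi(x)-\mu_i\|_2^2$, with $\mu_i=\pi(O_i)^{-1}\sum_{x\in O_i}\pi(x)\Phi(x)$, is exactly $\delta(\mathcal O)$. Retain the terminal partitions having $k$ nonempty blocks and denote them by $\mathcal O^{(1)},\ldots,\mathcal O^{(\ell)}$ (the candidates). (3) Candidate rescoring: evaluate the chosen objective $F_\star$ on every candidate and return a candidate $\widehat{\mathcal O}_\star$ minimizing $F_\star(\mathcal O^{(s)})$ over $1\le s\le\ell$. *)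

theory Defs
  imports "HOL-Analysis.Analysis"
begin

text \<open>
  The state space is the finite type \<open>'a\<close>. Functions on it are vectors of type \<open>real ^ 'a\<close>;
  kernels and operators are matrices of type \<open>real ^ 'a ^ 'a\<close>, with \<open>A(x,y)\<close> written
  \<open>A $ x $ y\<close> and \<open>A f\<close> written \<open>A *v f\<close>.
\<close>

section \<open>Markov kernels\<close>

text \<open>The power operation of type class \<open>power\<close> is not used for the iterates of a kernel, since the
  multiplication of the type \<open>vec\<close> is componentwise.\<close>

definition kernel_power :: "real ^ 'a ^ 'a \<Rightarrow> nat \<Rightarrow> real ^ 'a ^ 'a" where
  "kernel_power P t = (((**) P) ^^ t) (mat 1)"

definition markov_kernel :: "real ^ 'a ^ 'a \<Rightarrow> bool" where
  "markov_kernel P \<longleftrightarrow> (\<forall>x y. 0 \<le> P $ x $ y) \<and> (\<forall>x. (\<Sum>y\<in>UNIV. P $ x $ y) = 1)"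

definition irreducible_kernel :: "real ^ 'a ^ 'a \<Rightarrow> bool" where
  "irreducible_kernel P \<longleftrightarrow> (\<forall>x y. \<exists>t. 0 < kernel_power P t $ x $ y)"

definition aperiodic_kernel :: "real ^ 'a ^ 'a \<Rightarrow> bool" where
  "aperiodic_kernel P \<longleftrightarrow> (\<forall>x. Gcd {t. 1 \<le> t \<and> 0 < kernel_power P t $ x $ x} = 1)"

definition ergodic_kernel :: "real ^ 'a ^ 'a \<Rightarrow> bool" where
  "ergodic_kernel P \<longleftrightarrow> irreducible_kernel P \<and> aperiodic_kernel P"

definition positive_distribution :: "real ^ 'a \<Rightarrow> bool" where
  "positive_distribution \<pi> \<longleftrightarrow> (\<forall>x. 0 < \<pi> $ x) \<and> (\<Sum>x\<in>UNIV. \<pi> $ x) = 1"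

definition reversible_kernel :: "real ^ 'a \<Rightarrow> real ^ 'a ^ 'a \<Rightarrow> bool" where
  "reversible_kernel \<pi> P \<longleftrightarrow> (\<forall>x y. \<pi> $ x * P $ x $ y = \<pi> $ y * P $ y $ x)"

definition stationary_projection :: "real ^ 'a \<Rightarrow> real ^ 'a ^ 'a" where
  "stationary_projection \<pi> = (\<chi> x y. \<pi> $ y)"


section \<open>The weighted Hilbert space\<close>

definition inner_pi :: "real ^ 'a \<Rightarrow> real ^ 'a \<Rightarrow> real ^ 'a \<Rightarrow> real" where
  "inner_pi \<pi> f h = (\<Sum>x\<in>UNIV. \<pi> $ x * f $ x * h $ x)"

definition norm_pi :: "real ^ 'a \<Rightarrow> real ^ 'a \<Rightarrow> real" where
  "norm_pi \<pi> f = sqrt (inner_pi \<pi> f f)"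

definition l2_zero :: "real ^ 'a \<Rightarrow> (real ^ 'a) set" where
  "l2_zero \<pi> = {f. (\<Sum>x\<in>UNIV. \<pi> $ x * f $ x) = 0}"

definition adjoint_pi :: "real ^ 'a \<Rightarrow> real ^ 'a ^ 'a \<Rightarrow> real ^ 'a ^ 'a" where
  "adjoint_pi \<pi> A = (\<chi> x y. \<pi> $ y * A $ y $ x / \<pi> $ x)"

lemma inner_pi_adjoint_pi:
  assumes "positive_distribution \<pi>"
  shows "inner_pi \<pi> (A *v f) h = inner_pi \<pi> f (adjoint_pi \<pi> A *v h)"
proof -
  have nz: "\<pi> $ x \<noteq> 0" for x
    using assms by (metis positive_distribution_def less_irrefl)
  have "inner_pi \<pi> (A *v f) h
      = (\<Sum>x\<in>UNIV. \<Sum>y\<in>UNIV. \<pi> $ x * A $ x $ y * f $ y * h $ x)"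
    by (simp add: inner_pi_def matrix_vector_mult_def sum_distrib_left sum_distrib_right mult_ac)
  also have "\<dots> = (\<Sum>y\<in>UNIV. \<Sum>x\<in>UNIV. \<pi> $ x * A $ x $ y * f $ y * h $ x)"
    by (rule sum.swap)
  also have "\<dots> = inner_pi \<pi> f (adjoint_pi \<pi> A *v h)"
    using nz by (simp add: inner_pi_def adjoint_pi_def matrix_vector_mult_def
        sum_distrib_left sum_distrib_right mult_ac)
  finally show ?thesis .
qed

text \<open>The square of the Hilbert--Schmidt (Frobenius) norm of an operator on \<open>\<ell>\<^sup>2(\<pi>)\<close>.\<close>

definition frobenius_sq :: "real ^ 'a \<Rightarrow> real ^ 'a ^ 'a \<Rightarrow> real" where
  "frobenius_sq \<pi> A = trace (adjoint_pi \<pi> A ** A)"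

lemma frobenius_sq_eq_sum:
  "frobenius_sq \<pi> A = (\<Sum>x\<in>UNIV. \<Sum>y\<in>UNIV. \<pi> $ x / \<pi> $ y * (A $ x $ y)\<^sup>2)"
proof -
  have "frobenius_sq \<pi> A = (\<Sum>y\<in>UNIV. \<Sum>x\<in>UNIV. \<pi> $ x / \<pi> $ y * (A $ x $ y)\<^sup>2)"
    by (simp add: frobenius_sq_def trace_def matrix_matrix_mult_def adjoint_pi_def
        power2_eq_square mult_ac)
  also have "\<dots> = (\<Sum>x\<in>UNIV. \<Sum>y\<in>UNIV. \<pi> $ x / \<pi> $ y * (A $ x $ y)\<^sup>2)"
    by (rule sum.swap)
  finally show ?thesis .
qed

text \<open>
  With \<open>n = CARD('a)\<close>: \<open>\<phi> 1, \<dots>, \<phi> (n - 1)\<close> is a \<open>\<pi>\<close>-orthonormal basis of \<open>l2_zero \<pi>\<close> consisting of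
  common eigenfunctions of \<open>P\<^sup>2\<close> and \<open>P\<close>, and \<open>\<eta> 1 \<le> \<dots> \<le> \<eta> (n - 1)\<close> are the corresponding
  eigenvalues of \<open>P\<^sup>2\<close>. As \<open>\<phi>\<close> is a basis, this lists every eigenvalue of \<open>P\<^sup>2\<close> on \<open>l2_zero \<pi>\<close> with
  its multiplicity.
\<close>

definition spectral_basis ::
    "real ^ 'a \<Rightarrow> real ^ 'a ^ 'a \<Rightarrow> (nat \<Rightarrow> real) \<Rightarrow> (nat \<Rightarrow> real ^ 'a) \<Rightarrow> bool" where
  "spectral_basis \<pi> P \<eta> \<phi> \<longleftrightarrow>
     (\<forall>i\<in>{1..CARD('a) - 1}. \<forall>j\<in>{1..CARD('a) - 1}.
        inner_pi \<pi> (\<phi> i) (\<phi> j) = (if i = j then 1 else 0)) \<and>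
     span (\<phi> ` {1..CARD('a) - 1}) = l2_zero \<pi> \<and>
     (\<forall>j\<in>{1..CARD('a) - 1}. (P ** P) *v \<phi> j = \<eta> j *\<^sub>R \<phi> j) \<and>
     (\<forall>j\<in>{1..CARD('a) - 1}. \<exists>l::real. P *v \<phi> j = l *\<^sub>R \<phi> j) \<and>
     mono_on {1..CARD('a) - 1} \<eta>"


section \<open>Partitions and Gibbs kernels\<close>

definition k_partitions :: "nat \<Rightarrow> 'a set set set" where
  "k_partitions k = {\<O>. partition_on UNIV \<O> \<and> card \<O> = k}"

definition mass :: "real ^ 'a \<Rightarrow> 'a set \<Rightarrow> real" where
  "mass \<pi> B = (\<Sum>x\<in>B. \<pi> $ x)"

definition gibbs_kernel :: "real ^ 'a \<Rightarrow> 'a set set \<Rightarrow> real ^ 'a ^ 'a" where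
  "gibbs_kernel \<pi> \<O> =
     (\<chi> x y. \<Sum>B\<in>\<O>. indicator B x * indicator B y * \<pi> $ y / mass \<pi> B)"

definition spectral_defect ::
    "real ^ 'a \<Rightarrow> (nat \<Rightarrow> real ^ 'a) \<Rightarrow> nat \<Rightarrow> 'a set set \<Rightarrow> real" where
  "spectral_defect \<pi> \<phi> k \<O> =
     (\<Sum>j=1..k-1. (norm_pi \<pi> ((mat 1 - gibbs_kernel \<pi> \<O>) *v \<phi> j))\<^sup>2)"

definition horizon_error :: "real ^ 'a \<Rightarrow> real ^ 'a ^ 'a \<Rightarrow> nat \<Rightarrow> 'a set set \<Rightarrow> real" where
  "horizon_error \<pi> P t \<O> =
     frobenius_sq \<pi> (gibbs_kernel \<pi> \<O> ** kernel_power P t - stationary_projection \<pi>)"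

definition finite_horizon_objective ::
    "real ^ 'a \<Rightarrow> real ^ 'a ^ 'a \<Rightarrow> nat \<Rightarrow> (nat \<Rightarrow> real) \<Rightarrow> 'a set set \<Rightarrow> real" where
  "finite_horizon_objective \<pi> P T w \<O> = (\<Sum>t=1..T. w t * horizon_error \<pi> P t \<O>)"

text \<open>The series over \<open>t \<ge> 1\<close> with weights \<open>\<gamma> ^ (t - 1)\<close>, indexed from \<open>0\<close>; note \<open>0 ^ 0 = 1\<close>.\<close>

definition discounted_objective ::
    "real ^ 'a \<Rightarrow> real ^ 'a ^ 'a \<Rightarrow> real \<Rightarrow> 'a set set \<Rightarrow> real" where
  "discounted_objective \<pi> P \<gamma> \<O> = (\<Sum>t. \<gamma> ^ t * horizon_error \<pi> P (Suc t) \<O>)"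


section \<open>Weighted k-means and the multi-horizon spectral sweep\<close>

text \<open>Points of \<open>\<real>\<^sup>d\<close>, where \<open>d\<close> depends on the term variable \<open>k\<close>, are lists of length \<open>d\<close>.\<close>

definition spectral_embedding :: "(nat \<Rightarrow> real ^ 'a) \<Rightarrow> nat \<Rightarrow> 'a \<Rightarrow> real list" where
  "spectral_embedding \<phi> k x = map (\<lambda>j. \<phi> j $ x) [1..<k]"

definition centroid :: "real ^ 'a \<Rightarrow> nat \<Rightarrow> ('a \<Rightarrow> real list) \<Rightarrow> 'a set \<Rightarrow> real list" where
  "centroid \<pi> d \<Phi> B = map (\<lambda>i. (\<Sum>x\<in>B. \<pi> $ x * \<Phi> x ! i) / mass \<pi> B) [0..<d]"

definition kmeans_distortion ::
    "real ^ 'a \<Rightarrow> nat \<Rightarrow> ('a \<Rightarrow> real list) \<Rightarrow> 'a set set \<Rightarrow> real" where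
  "kmeans_distortion \<pi> d \<Phi> \<O> =
     (\<Sum>B\<in>\<O>. \<Sum>x\<in>B. \<pi> $ x * (L2_set (\<lambda>i. \<Phi> x ! i - centroid \<pi> d \<Phi> B ! i) {..<d})\<^sup>2)"

definition kmeans_approximation ::
    "real ^ 'a \<Rightarrow> nat \<Rightarrow> ('a \<Rightarrow> real list) \<Rightarrow> nat \<Rightarrow> real \<Rightarrow> 'a set set \<Rightarrow> bool" where
  "kmeans_approximation \<pi> d \<Phi> k \<rho> \<O> \<longleftrightarrow>
     kmeans_distortion \<pi> d \<Phi> \<O> \<le> \<rho> * (MIN \<Q>\<in>k_partitions k. kmeans_distortion \<pi> d \<Phi> \<Q>)"

text \<open>
  A weighted k-means procedure receives the number of clusters, the weights, the points and an
  initialization, and returns a terminal assignment of states to the clusters \<open>0, \<dots>, k - 1\<close>, some of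
  which may be empty. The sweep does not depend on which procedure is used, so it is a
  parameter, and so is the type \<open>'i\<close> of initializations.
\<close>

type_synonym ('a, 'i) kmeans_procedure =
  "nat \<Rightarrow> real ^ 'a \<Rightarrow> ('a \<Rightarrow> real list) \<Rightarrow> 'i \<Rightarrow> 'a \<Rightarrow> nat"

definition clusters :: "nat \<Rightarrow> ('a \<Rightarrow> nat) \<Rightarrow> 'a set set" where
  "clusters k c = (\<lambda>i. {x. c x = i}) ` {..<k}"

text \<open>Steps (1) and (2). If one of the \<open>k\<close> clusters is empty then \<open>{} \<in> clusters k c\<close>, so that
  \<open>clusters k c\<close> is not a partition and is discarded by the filter.\<close>

definition sweep_candidates ::
    "('a, 'i) kmeans_procedure \<Rightarrow> 'i list \<Rightarrow> real ^ 'a \<Rightarrow> (nat \<Rightarrow> real ^ 'a) \<Rightarrow> nat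
      \<Rightarrow> 'a set set list" where
  "sweep_candidates kmeans inits \<pi> \<phi> k =
     filter (\<lambda>\<O>. \<O> \<in> k_partitions k)
       (map (\<lambda>s. clusters k (kmeans k \<pi> (spectral_embedding \<phi> k) s)) inits)"

text \<open>Step (3). Ties may be broken arbitrarily, so the output is described by a predicate. It has
  an instance only if there is at least one candidate.\<close>

definition sweep_output ::
    "('a set set \<Rightarrow> real) \<Rightarrow> 'a set set list \<Rightarrow> 'a set set \<Rightarrow> bool" where
  "sweep_output F cands \<O> \<longleftrightarrow> is_arg_min F (\<lambda>\<Q>. \<Q> \<in> set cands) \<O>"

end

theory Submission
  imports Defs
begin

text \<open>
  Every objective is \<open>F(\<O>) = (\<Sum>j. \<beta>\<^sub>j a\<^sub>j)\<close> with \<open>a\<^sub>j = \<parallel>G\<^sub>\<O> \<phi>\<^sub>j\<parallel>\<^sup>2 \<in> [0, 1]\<close>: evaluate the Frobenius norm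
  in the orthonormal basis \<open>1, \<phi>\<^sub>1, \<dots>, \<phi>\<^sub>n\<^sub>-\<^sub>1\<close>. Since \<open>G\<^sub>\<O>\<close> is an orthogonal projection of trace \<open>k\<close>
  fixing \<open>1\<close>, the \<open>a\<^sub>j\<close> sum to \<open>k - 1\<close>, so the mass \<open>\<delta>(\<O>) = (\<Sum>j<k. 1 - a\<^sub>j)\<close> missing below \<open>k\<close>
  is exactly the mass present from \<open>k\<close> on. As \<open>\<beta>\<close> is increasing, moving it costs between \<open>g \<delta>(\<O>)\<close>
  and \<open>W \<delta>(\<O>)\<close> in comparison with the ideal value \<open>\<beta>\<^sub>1 + \<dots> + \<beta>\<^sub>k\<^sub>-\<^sub>1\<close>.
\<close>

section \<open>Bilinear algebra of the weighted inner product\<close>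

lemma inner_pi_commute: "inner_pi \<pi> f h = inner_pi \<pi> h f"
  by (simp add: inner_pi_def mult_ac)

lemma inner_pi_add_left: "inner_pi \<pi> (f + g) h = inner_pi \<pi> f h + inner_pi \<pi> g h"
  by (simp add: inner_pi_def algebra_simps sum.distrib)

lemma inner_pi_diff_left: "inner_pi \<pi> (f - g) h = inner_pi \<pi> f h - inner_pi \<pi> g h"
  by (simp add: inner_pi_def algebra_simps sum_subtractf)

lemma inner_pi_diff_right: "inner_pi \<pi> h (f - g) = inner_pi \<pi> h f - inner_pi \<pi> h g"
  by (simp add: inner_pi_def algebra_simps sum_subtractf)

lemma inner_pi_scaleR_left: "inner_pi \<pi> (c *\<^sub>R f) h = c * inner_pi \<pi> f h"
  by (simp add: inner_pi_def sum_distrib_left mult_ac)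

lemma inner_pi_scaleR_right: "inner_pi \<pi> h (c *\<^sub>R f) = c * inner_pi \<pi> h f"
  by (simp add: inner_pi_def sum_distrib_left mult_ac)

lemma inner_pi_zero_left: "inner_pi \<pi> 0 h = 0"
  by (simp add: inner_pi_def)

lemma inner_pi_self_nonneg:
  assumes "positive_distribution \<pi>"
  shows "0 \<le> inner_pi \<pi> f f"
proof -
  have "inner_pi \<pi> f f = (\<Sum>x\<in>UNIV. \<pi> $ x * (f $ x)\<^sup>2)"
    by (simp add: inner_pi_def power2_eq_square mult.assoc)
  then show ?thesis
    using assms by (simp add: positive_distribution_def sum_nonneg less_imp_le)
qed

lemma norm_pi_squared:
  assumes "positive_distribution \<pi>"
  shows "(norm_pi \<pi> f)\<^sup>2 = inner_pi \<pi> f f"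
  by (simp add: norm_pi_def inner_pi_self_nonneg[OF assms])

text \<open>Isolates the product \<open>e $ y * e $ z\<close>, so that a sum over basis vectors can
  later be evaluated entry by entry.\<close>

lemma inner_pi_matrix_vector:
  "inner_pi \<pi> (A *v e) (A *v e)
     = (\<Sum>x\<in>UNIV. \<Sum>y\<in>UNIV. \<Sum>z\<in>UNIV. \<pi> $ x * A $ x $ y * A $ x $ z * (e $ y * e $ z))"
  by (simp add: inner_pi_def matrix_vector_mult_def sum_distrib_left sum_distrib_right mult_ac)


section \<open>Orthonormal bases of the weighted space\<close>

text \<open>The reconstruction formula of a Parseval frame; traces and Frobenius norms are evaluated
  directly from it.\<close>

definition complete_system :: "real ^ 'a \<Rightarrow> 'i set \<Rightarrow> ('i \<Rightarrow> real ^ 'a) \<Rightarrow> bool" where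
  "complete_system \<pi> I e \<longleftrightarrow> (\<forall>f. f = (\<Sum>i\<in>I. inner_pi \<pi> f (e i) *\<^sub>R e i))"

lemma sum_mult_delta:
  fixes c :: "'a::finite \<Rightarrow> real"
  shows "(\<Sum>z\<in>UNIV. c z * (if y = z then d else 0)) = c y * d"
  by (subst sum.remove[of _ y]) auto

text \<open>Expand the point mass at \<open>x\<close>: its coefficients are
  \<open>\<pi> $ x * e i $ x\<close>. Reading off coordinate \<open>y\<close> gives the kernel of
  the identity, and dividing by \<open>\<pi> $ x\<close> produces the diagonal weight.\<close>

lemma complete_system_kernel:
  assumes "positive_distribution \<pi>" "complete_system \<pi> I e"
  shows "(\<Sum>i\<in>I. e i $ x * e i $ y) = (if x = y then 1 / \<pi> $ x else 0)"
proof -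
  have nz: "\<pi> $ x \<noteq> 0"
    using assms(1) by (metis positive_distribution_def less_irrefl)
  have "inner_pi \<pi> (axis x 1) h = \<pi> $ x * h $ x" for h
    by (simp add: inner_pi_def axis_def if_distrib[of "\<lambda>c. _ * c * _"] cong: if_cong)
  moreover have "axis x 1 = (\<Sum>i\<in>I. inner_pi \<pi> (axis x 1) (e i) *\<^sub>R e i)"
    using assms(2) unfolding complete_system_def by (rule spec)
  ultimately have "axis x 1 = (\<Sum>i\<in>I. (\<pi> $ x * e i $ x) *\<^sub>R e i)"
    by simp
  then have "(axis x 1 :: real ^ 'a) $ y = (\<Sum>i\<in>I. (\<pi> $ x * e i $ x) *\<^sub>R e i) $ y"
    by simp
  then have "(if x = y then 1 else 0) = \<pi> $ x * (\<Sum>i\<in>I. e i $ x * e i $ y)"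
    by (auto simp: axis_def sum_distrib_left mult_ac)
  then show ?thesis
    using nz by (auto simp: field_simps)
qed

text \<open>Once the sum over \<open>i\<close> is innermost, \<open>complete_system_kernel\<close>
  forces \<open>y = z\<close>, which leaves the entrywise formula of the Frobenius norm.\<close>

lemma frobenius_sq_eq_sum_norms:
  assumes "positive_distribution \<pi>" "complete_system \<pi> I e"
  shows "frobenius_sq \<pi> A = (\<Sum>i\<in>I. inner_pi \<pi> (A *v e i) (A *v e i))"
proof -
  have "(\<Sum>i\<in>I. inner_pi \<pi> (A *v e i) (A *v e i)) =
      (\<Sum>x\<in>UNIV. \<Sum>y\<in>UNIV. \<Sum>z\<in>UNIV. \<Sum>i\<in>I. \<pi> $ x * A $ x $ y * A $ x $ z * (e i $ y * e i $ z))"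
    unfolding inner_pi_matrix_vector
    \<comment> \<open>Each swap carries the sum over \<open>i\<close> past one of \<open>x\<close>,
      \<open>y\<close>, \<open>z\<close>.\<close>
    by (rule trans[OF sum.swap], intro sum.cong refl, rule trans[OF sum.swap], intro sum.cong refl,
        rule sum.swap)
  also have "\<dots> = (\<Sum>x\<in>UNIV. \<Sum>y\<in>UNIV. \<Sum>z\<in>UNIV.
      \<pi> $ x * A $ x $ y * A $ x $ z * (if y = z then 1 / \<pi> $ y else 0))"
    by (simp only: sum_distrib_left[symmetric] complete_system_kernel[OF assms])
  also have "\<dots> = frobenius_sq \<pi> A"
    by (simp only: frobenius_sq_eq_sum power2_eq_square sum_mult_delta) (simp add: mult_ac)
  finally show ?thesis ..
qed

lemma trace_eq_sum_inner_pi: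
  assumes "positive_distribution \<pi>" "complete_system \<pi> I e"
  shows "trace A = (\<Sum>i\<in>I. inner_pi \<pi> (A *v e i) (e i))"
proof -
  have nz: "\<pi> $ x \<noteq> 0" for x
    using assms(1) by (metis positive_distribution_def less_irrefl)
  have "(\<Sum>i\<in>I. inner_pi \<pi> (A *v e i) (e i)) =
      (\<Sum>i\<in>I. \<Sum>x\<in>UNIV. \<Sum>y\<in>UNIV. \<pi> $ x * A $ x $ y * (e i $ x * e i $ y))"
    by (simp add: inner_pi_def matrix_vector_mult_def sum_distrib_left sum_distrib_right mult_ac)
  also have "\<dots> = (\<Sum>x\<in>UNIV. \<Sum>y\<in>UNIV. \<Sum>i\<in>I. \<pi> $ x * A $ x $ y * (e i $ x * e i $ y))"
    by (rule trans[OF sum.swap], intro sum.cong refl, rule sum.swap)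
  also have "\<dots> = (\<Sum>x\<in>UNIV. \<Sum>y\<in>UNIV. \<pi> $ x * A $ x $ y * (if x = y then 1 / \<pi> $ x else 0))"
    by (simp only: sum_distrib_left[symmetric] complete_system_kernel[OF assms])
  also have "\<dots> = trace A"
    using nz by (simp add: trace_def sum_mult_delta)
  finally show ?thesis ..
qed

text \<open>The eigenbasis starts at index 1, so slot 0 is free for the constant function. Removing
  the mean of \<open>f\<close> lands in \<open>l2_zero \<pi>\<close>, where the \<phi> expansion is
  available.\<close>

lemma spectral_basis_complete:
  fixes \<phi> :: "nat \<Rightarrow> real ^ 'a"
  assumes "positive_distribution \<pi>" "spectral_basis \<pi> P \<eta> \<phi>"
  shows "complete_system \<pi> {0..CARD('a) - 1} (\<phi>(0 := 1))"
  unfolding complete_system_def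
proof
  fix f :: "real ^ 'a"
  let ?I = "{1..CARD('a) - 1}" and ?c = "inner_pi \<pi> f 1"
  have orth: "inner_pi \<pi> (\<phi> i) (\<phi> j) = (if i = j then 1 else 0)" if "i \<in> ?I" "j \<in> ?I" for i j
    using assms(2) that by (auto simp: spectral_basis_def)
  have sp: "span (\<phi> ` ?I) = l2_zero \<pi>"
    using assms(2) by (auto simp: spectral_basis_def)
  have expand: "h = (\<Sum>i\<in>?I. inner_pi \<pi> h (\<phi> i) *\<^sub>R \<phi> i)" if "h \<in> l2_zero \<pi>" for h
  proof -
    \<comment> \<open>The Fourier sum operator is linear and fixes every \<open>\<phi> j\<close>,
      hence it is the identity on their span.\<close>
    define p where "p h = (\<Sum>i\<in>?I. inner_pi \<pi> h (\<phi> i) *\<^sub>R \<phi> i)" for h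
    have "p (\<phi> j) = \<phi> j" if "j \<in> ?I" for j
    proof -
      have "p (\<phi> j) = (\<Sum>i\<in>?I. if j = i then \<phi> i else 0)"
        unfolding p_def by (rule sum.cong) (simp_all add: orth[OF that])
      then show ?thesis
        using that by simp
    qed
    then have agree: "p f = id f" if "f \<in> \<phi> ` ?I" for f
      using that by auto
    have lin: "linear p"
      by (rule linearI)
        (simp_all add: p_def inner_pi_add_left inner_pi_scaleR_left scaleR_left_distrib sum.distrib
          scaleR_sum_right)
    have mem: "h \<in> span (\<phi> ` ?I)"
      using that sp by simp
    have "p h = id h"
      by (rule linear_eq_on_span[OF lin linear_id agree mem])
    then show ?thesis
      by (simp add: p_def)
  qed
  have mean: "inner_pi \<pi> h 1 = (\<Sum>x\<in>UNIV. \<pi> $ x * h $ x)" for h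
    by (simp add: inner_pi_def)
  have one: "inner_pi \<pi> 1 1 = 1"
    using assms(1) by (simp add: mean positive_distribution_def)
  have "f - ?c *\<^sub>R 1 \<in> l2_zero \<pi>"
    by (simp add: l2_zero_def mean[symmetric] del: vector_minus_component)
      (simp add: inner_pi_diff_left inner_pi_scaleR_left one)
  note * = expand[OF this]
  \<comment> \<open>Constants are orthogonal to each \<open>\<phi> i\<close>, so subtracting the
    mean leaves the coefficients of \<open>f\<close> unchanged.\<close>
  have "inner_pi \<pi> 1 (\<phi> i) = 0" if "i \<in> ?I" for i
  proof -
    have "\<phi> i \<in> l2_zero \<pi>"
      using sp span_base[of "\<phi> i" "\<phi> ` ?I"] that by blast
    then show ?thesis
      by (simp add: inner_pi_commute[of \<pi> "1"] mean l2_zero_def)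
  qed
  then have "f - ?c *\<^sub>R 1 = (\<Sum>i\<in>?I. inner_pi \<pi> f (\<phi> i) *\<^sub>R \<phi> i)"
    by (subst *) (auto simp: inner_pi_diff_left inner_pi_scaleR_left intro!: sum.cong)
  then have "f = ?c *\<^sub>R 1 + (\<Sum>i\<in>?I. inner_pi \<pi> f (\<phi> i) *\<^sub>R \<phi> i)"
    by (simp add: algebra_simps)
  also have "\<dots> = (\<Sum>i\<in>{0..CARD('a) - 1}. inner_pi \<pi> f ((\<phi>(0 := 1)) i) *\<^sub>R (\<phi>(0 := 1)) i)"
    by (subst (2) sum.atLeast_Suc_atMost) (auto intro!: sum.cong)
  finally show "f = (\<Sum>i\<in>{0..CARD('a) - 1}. inner_pi \<pi> f ((\<phi>(0 := 1)) i) *\<^sub>R (\<phi>(0 := 1)) i)" .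
qed


section \<open>The Gibbs projection\<close>

lemma mass_pos:
  assumes "positive_distribution \<pi>" "B \<noteq> {}"
  shows "0 < mass \<pi> B"
  using assms by (auto simp: mass_def positive_distribution_def intro!: sum_pos)

lemma partition_sum:
  fixes \<O> :: "'a::finite set set" and f :: "'a \<Rightarrow> 'b::comm_monoid_add"
  assumes "partition_on UNIV \<O>"
  shows "sum f UNIV = (\<Sum>B\<in>\<O>. sum f B)"
proof -
  have "sum f (\<Union>\<O>) = (\<Sum>B\<in>\<O>. sum f B)"
    using assms by (subst sum.Union_disjoint) (auto simp: partition_on_def disjoint_def)
  then show ?thesis
    using assms by (simp add: partition_on_def)
qed

text \<open>Blocks are disjoint, so only the summand of the block containing \<open>x\<close>
  survives.\<close>

lemma gibbs_kernel_block:
  assumes "partition_on UNIV \<O>" "B \<in> \<O>" "x \<in> B"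
  shows "gibbs_kernel \<pi> \<O> $ x $ y = indicator B y * \<pi> $ y / mass \<pi> B"
proof -
  have *: "indicator C x = (if C = B then 1 else 0 :: real)" if "C \<in> \<O>" for C
    using assms that by (auto simp: partition_on_def disjoint_def indicator_def)
  have "gibbs_kernel \<pi> \<O> $ x $ y
      = (\<Sum>C\<in>\<O>. if C = B then indicator C y * \<pi> $ y / mass \<pi> C else 0)"
    unfolding gibbs_kernel_def by (simp only: vec_lambda_beta, intro sum.cong refl) (simp add: *)
  then show ?thesis
    using assms by simp
qed

text \<open>The Gibbs kernel is conditional expectation given the block: it replaces
  \<open>f\<close> by its weighted block averages.\<close>

lemma gibbs_kernel_apply:
  assumes "partition_on UNIV \<O>" "B \<in> \<O>" "x \<in> B"
  shows "(gibbs_kernel \<pi> \<O> *v f) $ x = (\<Sum>y\<in>B. \<pi> $ y * f $ y) / mass \<pi> B"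
proof -
  have "(gibbs_kernel \<pi> \<O> *v f) $ x = (\<Sum>y\<in>UNIV. indicator B y * (\<pi> $ y * f $ y / mass \<pi> B))"
    by (simp add: matrix_vector_mult_def gibbs_kernel_block[OF assms] mult.assoc)
  also have "\<dots> = (\<Sum>y\<in>B. \<pi> $ y * f $ y / mass \<pi> B)"
    by (rule sum.mono_neutral_cong_right) auto
  finally show ?thesis
    by (simp add: sum_divide_distrib)
qed

lemma partition_block:
  assumes "partition_on UNIV \<O>"
  obtains B where "B \<in> \<O>" "x \<in> B"
  using assms that unfolding partition_on_def by blast

lemma gibbs_kernel_const:
  assumes "positive_distribution \<pi>" "partition_on UNIV \<O>"
  shows "gibbs_kernel \<pi> \<O> *v 1 = 1"
proof (rule vec_eq_iff[THEN iffD2], rule allI)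
  fix x
  obtain B where B: "B \<in> \<O>" "x \<in> B"
    using assms(2) by (rule partition_block)
  then have "mass \<pi> B \<noteq> 0"
    using mass_pos[OF assms(1), of B] by fastforce
  then show "(gibbs_kernel \<pi> \<O> *v 1) $ x = (1 :: real ^ 'a) $ x"
    using gibbs_kernel_apply[OF assms(2) B, of \<pi> "1"] by (simp add: mass_def)
qed

lemma gibbs_kernel_idem:
  assumes "positive_distribution \<pi>" "partition_on UNIV \<O>"
  shows "gibbs_kernel \<pi> \<O> *v (gibbs_kernel \<pi> \<O> *v f) = gibbs_kernel \<pi> \<O> *v f"
proof (rule vec_eq_iff[THEN iffD2], rule allI)
  fix x
  obtain B where B: "B \<in> \<O>" "x \<in> B"
    using assms(2) by (rule partition_block)
  then have "mass \<pi> B \<noteq> 0"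
    using mass_pos[OF assms(1), of B] by fastforce
  then show "(gibbs_kernel \<pi> \<O> *v (gibbs_kernel \<pi> \<O> *v f)) $ x = (gibbs_kernel \<pi> \<O> *v f) $ x"
    \<comment> \<open>Membership in \<open>B\<close> is left as a premise of the rewrite rule, so it
      applies both at \<open>x\<close> and at every summation point of the block.\<close>
    using B by (simp add: gibbs_kernel_apply[OF assms(2) B(1)] sum_divide_distrib[symmetric]
        sum_distrib_right[symmetric] mass_def[symmetric])
qed

text \<open>Detailed balance: \<open>\<pi> $ x\<close> times the entry at \<open>x\<close>,
  \<open>y\<close> is symmetric in the two points.\<close>

lemma gibbs_kernel_self_adjoint:
  assumes "positive_distribution \<pi>"
  shows "adjoint_pi \<pi> (gibbs_kernel \<pi> \<O>) = gibbs_kernel \<pi> \<O>"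
proof -
  have "\<pi> $ x \<noteq> 0" for x
    using assms by (metis positive_distribution_def less_irrefl)
  then show ?thesis
    by (auto simp: vec_eq_iff adjoint_pi_def gibbs_kernel_def sum_distrib_left sum_divide_distrib
        intro!: sum.cong)
qed

text \<open>Self-adjointness and idempotence combined. This turns squared norms into diagonal terms
  of a trace.\<close>

lemma gibbs_kernel_norm:
  assumes "positive_distribution \<pi>" "partition_on UNIV \<O>"
  shows "inner_pi \<pi> (gibbs_kernel \<pi> \<O> *v f) (gibbs_kernel \<pi> \<O> *v f)
           = inner_pi \<pi> (gibbs_kernel \<pi> \<O> *v f) f"
  by (subst inner_pi_adjoint_pi[OF assms(1)])
    (simp add: gibbs_kernel_self_adjoint[OF assms(1)] gibbs_kernel_idem[OF assms]
      inner_pi_commute)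

text \<open>Pythagoras for the orthogonal projection onto block-constant functions.\<close>

lemma gibbs_kernel_defect:
  assumes "positive_distribution \<pi>" "partition_on UNIV \<O>"
  shows "(norm_pi \<pi> ((mat 1 - gibbs_kernel \<pi> \<O>) *v f))\<^sup>2
           = inner_pi \<pi> f f - inner_pi \<pi> (gibbs_kernel \<pi> \<O> *v f) (gibbs_kernel \<pi> \<O> *v f)"
  using gibbs_kernel_norm[OF assms, of f]
    inner_pi_commute[of \<pi> f "gibbs_kernel \<pi> \<O> *v f"]
  by (simp add: norm_pi_squared[OF assms(1)] matrix_vector_mult_diff_rdistrib
      inner_pi_diff_left inner_pi_diff_right)

text \<open>The diagonal entries of one block are its conditional probabilities and add up to
  1.\<close>

lemma trace_gibbs_kernel:
  assumes "positive_distribution \<pi>" "partition_on UNIV \<O>"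
  shows "trace (gibbs_kernel \<pi> \<O>) = card \<O>"
proof -
  have "trace (gibbs_kernel \<pi> \<O>) = (\<Sum>B\<in>\<O>. \<Sum>x\<in>B. gibbs_kernel \<pi> \<O> $ x $ x)"
    unfolding trace_def by (rule partition_sum[OF assms(2)])
  also have "\<dots> = (\<Sum>B\<in>\<O>. \<Sum>x\<in>B. \<pi> $ x / mass \<pi> B)"
    by (auto simp: gibbs_kernel_block[OF assms(2)] intro!: sum.cong)
  also have "\<dots> = (\<Sum>B\<in>\<O>. 1)"
  proof (rule sum.cong[OF refl])
    fix B assume "B \<in> \<O>"
    then have "mass \<pi> B \<noteq> 0"
      using mass_pos[OF assms(1), of B] assms(2) unfolding partition_on_def by force
    then show "(\<Sum>x\<in>B. \<pi> $ x / mass \<pi> B) = 1"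
      by (simp add: sum_divide_distrib[symmetric] mass_def[symmetric])
  qed
  finally show ?thesis by simp
qed

text \<open>Each centroid coordinate is a block average of an eigenfunction, which is the value of
  the Gibbs kernel there. List positions start at 0 and eigenfunctions at 1, hence the
  \<open>Suc i\<close>.\<close>

lemma kmeans_distortion_eq_spectral_defect:
  assumes "positive_distribution \<pi>" "partition_on UNIV \<O>"
  shows "kmeans_distortion \<pi> (k - 1) (spectral_embedding \<phi> k) \<O> = spectral_defect \<pi> \<phi> k \<O>"
proof -
  let ?G = "gibbs_kernel \<pi> \<O>"
  have "kmeans_distortion \<pi> (k - 1) (spectral_embedding \<phi> k) \<O>
      = (\<Sum>B\<in>\<O>. \<Sum>x\<in>B. \<Sum>i<k-1. \<pi> $ x * (((mat 1 - ?G) *v \<phi> (Suc i)) $ x)\<^sup>2)"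
    unfolding kmeans_distortion_def
    by (intro sum.cong refl)
      (simp add: L2_set_def sum_nonneg sum_distrib_left centroid_def spectral_embedding_def
        matrix_vector_mult_diff_rdistrib gibbs_kernel_apply[OF assms(2)])
  also have "\<dots> = (\<Sum>x\<in>UNIV. \<Sum>i<k-1. \<pi> $ x * (((mat 1 - ?G) *v \<phi> (Suc i)) $ x)\<^sup>2)"
    by (rule partition_sum[OF assms(2), symmetric])
  also have "\<dots> = (\<Sum>i<k-1. (norm_pi \<pi> ((mat 1 - ?G) *v \<phi> (Suc i)))\<^sup>2)"
    by (subst sum.swap)
      (simp add: norm_pi_squared[OF assms(1)] inner_pi_def power2_eq_square[of "_ $ _"] mult.assoc)
  also have "\<dots> = spectral_defect \<pi> \<phi> k \<O>"
    unfolding spectral_defect_def by (rule sum.reindex_bij_witness[of _ "\<lambda>i. i - 1" Suc]) auto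
  finally show ?thesis .
qed


section \<open>Spectral form of the objectives\<close>

text \<open>The energy of \<open>f\<close> that survives block averaging; at \<open>\<phi> j\<close>
  this is the coefficient called \<open>a\<close> in the overview.\<close>

definition capture :: "real ^ 'a \<Rightarrow> 'a set set \<Rightarrow> real ^ 'a \<Rightarrow> real" where
  "capture \<pi> \<O> f = inner_pi \<pi> (gibbs_kernel \<pi> \<O> *v f) (gibbs_kernel \<pi> \<O> *v f)"

lemma kernel_power_Suc_apply: "kernel_power P (Suc t) *v f = P *v (kernel_power P t *v f)"
  by (simp add: kernel_power_def matrix_vector_mul_assoc)

lemma kernel_power_eigenvector:
  assumes "P *v f = l *\<^sub>R f"
  shows "kernel_power P t *v f = l ^ t *\<^sub>R f"
proof (induction t)
  case 0
  then show ?case by (simp add: kernel_power_def)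
next
  case (Suc t)
  then show ?case
    by (simp add: kernel_power_Suc_apply matrix_vector_mult_scaleR assms mult.commute)
qed

lemma markov_kernel_const:
  assumes "markov_kernel P"
  shows "P *v 1 = 1"
  using assms by (simp add: markov_kernel_def vec_eq_iff matrix_vector_mult_def)

text \<open>Maximum principle: where the absolute value of \<open>f\<close> is largest, averaging
  against a row of \<open>P\<close> cannot exceed it.\<close>

lemma markov_kernel_eigenvalue_le_1:
  fixes P :: "real ^ 'a ^ 'a"
  assumes "markov_kernel P" "P *v f = l *\<^sub>R f" "f \<noteq> 0"
  shows "\<bar>l\<bar> \<le> 1"
proof -
  obtain x where x: "\<bar>f $ x\<bar> = Max (range (\<lambda>y. \<bar>f $ y\<bar>))"
    using Max_in[of "range (\<lambda>y. \<bar>f $ y\<bar>)"] by fastforce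
  then have le: "\<bar>f $ y\<bar> \<le> \<bar>f $ x\<bar>" for y
    by simp
  obtain y where "f $ y \<noteq> 0"
    using assms(3) by (auto simp: vec_eq_iff)
  then have pos: "0 < \<bar>f $ x\<bar>"
    using le[of y] by linarith
  have "\<bar>l\<bar> * \<bar>f $ x\<bar> = \<bar>(P *v f) $ x\<bar>"
    by (simp add: assms(2) abs_mult)
  also have "\<dots> \<le> (\<Sum>y\<in>UNIV. \<bar>P $ x $ y * f $ y\<bar>)"
    unfolding matrix_vector_mult_def by simp
  also have "\<dots> \<le> (\<Sum>y\<in>UNIV. P $ x $ y * \<bar>f $ x\<bar>)"
    using assms(1) le by (auto simp: abs_mult markov_kernel_def intro!: sum_mono mult_mono)
  also have "\<dots> = \<bar>f $ x\<bar>"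
    using assms(1) by (simp add: sum_distrib_right[symmetric] markov_kernel_def)
  finally show ?thesis
    using pos by simp
qed

section \<open>Eigenvalue bounds and spectral expansions for a fixed eigenbasis\<close>

locale spectral_setting =
  fixes \<pi> :: "real ^ 'a" and P :: "real ^ 'a ^ 'a"
    and \<eta> :: "nat \<Rightarrow> real" and \<phi> :: "nat \<Rightarrow> real ^ 'a"
  assumes distr: "positive_distribution \<pi>"
    and markov: "markov_kernel P"
    and basis: "spectral_basis \<pi> P \<eta> \<phi>"
begin

lemma basis_unit: "j \<in> {1..CARD('a) - 1} \<Longrightarrow> inner_pi \<pi> (\<phi> j) (\<phi> j) = 1"
  using basis by (auto simp: spectral_basis_def)

lemma basis_mean_zero:
  assumes "j \<in> {1..CARD('a) - 1}"
  shows "(\<Sum>x\<in>UNIV. \<pi> $ x * \<phi> j $ x) = 0"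
proof -
  have "\<phi> j \<in> l2_zero \<pi>"
    using basis span_base[of "\<phi> j" "\<phi> ` {1..CARD('a) - 1}"] assms unfolding spectral_basis_def by blast
  then show ?thesis
    by (simp add: l2_zero_def)
qed

text \<open>Exposes the possibly negative eigenvalue \<open>l\<close> of \<open>P\<close> itself, by
  which the iterates of \<open>P\<close> act; comparing the two eigenvalue equations of
  \<open>P ** P\<close> on the nonzero \<open>\<phi> j\<close> gives the square.\<close>

lemma basis_eigenvalue:
  assumes "j \<in> {1..CARD('a) - 1}"
  obtains l where "P *v \<phi> j = l *\<^sub>R \<phi> j" "\<eta> j = l\<^sup>2" "\<bar>l\<bar> \<le> 1"
proof -
  obtain l where l: "P *v \<phi> j = l *\<^sub>R \<phi> j"
    using basis assms unfolding spectral_basis_def by blast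
  have nz: "\<phi> j \<noteq> 0"
    using basis_unit[OF assms] by (auto simp: inner_pi_zero_left)
  have "(P ** P) *v \<phi> j = \<eta> j *\<^sub>R \<phi> j"
    using basis assms unfolding spectral_basis_def by blast
  moreover have "(P ** P) *v \<phi> j = l\<^sup>2 *\<^sub>R \<phi> j"
    by (simp add: matrix_vector_mul_assoc[symmetric] l matrix_vector_mult_scaleR power2_eq_square)
  ultimately have "\<eta> j *\<^sub>R \<phi> j = l\<^sup>2 *\<^sub>R \<phi> j"
    by (rule trans[OF sym])
  then have "\<eta> j = l\<^sup>2"
    using nz by (simp only: scaleR_cancel_right simp_thms)
  then show ?thesis
    using that l markov_kernel_eigenvalue_le_1[OF markov l nz] by blast
qed

lemma eigenvalue_bounds:
  assumes "j \<in> {1..CARD('a) - 1}"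
  shows "0 \<le> \<eta> j" "\<eta> j \<le> 1"
  by (rule basis_eigenvalue[OF assms], simp add: abs_square_le_1)+

lemma eigenvalue_mono: "mono_on {1..CARD('a) - 1} \<eta>"
  using basis by (simp add: spectral_basis_def)

context
  fixes \<O> :: "'a set set"
  assumes partition: "partition_on UNIV \<O>"
begin

lemma capture_const: "capture \<pi> \<O> 1 = 1"
  using distr by (simp add: capture_def gibbs_kernel_const[OF distr partition] inner_pi_def
      positive_distribution_def)

lemma capture_bounds:
  assumes "j \<in> {1..CARD('a) - 1}"
  shows "0 \<le> capture \<pi> \<O> (\<phi> j)" "capture \<pi> \<O> (\<phi> j) \<le> 1"
proof -
  show "0 \<le> capture \<pi> \<O> (\<phi> j)"
    by (simp add: capture_def inner_pi_self_nonneg[OF distr])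
  show "capture \<pi> \<O> (\<phi> j) \<le> 1"
    using gibbs_kernel_defect[OF distr partition, of "\<phi> j"] basis_unit[OF assms]
      zero_le_power2[of "norm_pi \<pi> ((mat 1 - gibbs_kernel \<pi> \<O>) *v \<phi> j)"]
    unfolding capture_def by linarith
qed

text \<open>Compute the trace of the Gibbs kernel in the basis with the constant added; the constant
  alone contributes 1.\<close>

lemma sum_capture: "(\<Sum>j=1..CARD('a) - 1. capture \<pi> \<O> (\<phi> j)) = real (card \<O>) - 1"
proof -
  have "real (card \<O>) = (\<Sum>j=0..CARD('a) - 1. capture \<pi> \<O> ((\<phi>(0 := 1)) j))"
    using trace_eq_sum_inner_pi[OF distr spectral_basis_complete[OF distr basis],
        of "gibbs_kernel \<pi> \<O>"]
    by (simp add: trace_gibbs_kernel[OF distr partition] capture_def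
        gibbs_kernel_norm[OF distr partition])
  also have "\<dots> = 1 + (\<Sum>j=1..CARD('a) - 1. capture \<pi> \<O> (\<phi> j))"
    by (subst sum.atLeast_Suc_atMost) (auto simp: capture_const intro!: sum.cong)
  finally show ?thesis by simp
qed

lemma spectral_defect_eq:
  assumes "k - 1 \<le> CARD('a) - 1"
  shows "spectral_defect \<pi> \<phi> k \<O> = (\<Sum>j=1..k-1. 1 - capture \<pi> \<O> (\<phi> j))"
  unfolding spectral_defect_def capture_def
  using assms by (intro sum.cong refl) (simp add: gibbs_kernel_defect[OF distr partition] basis_unit)

text \<open>The error operator annihilates the constant, and the stationary projection annihilates
  each \<open>\<phi> j\<close>. What remains is \<open>l ^ t\<close> times the projected
  eigenfunction, whose squared norm carries the factor \<open>\<eta> j ^ t\<close>.\<close>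

lemma horizon_error_eq:
  "horizon_error \<pi> P t \<O> = (\<Sum>j=1..CARD('a) - 1. \<eta> j ^ t * capture \<pi> \<O> (\<phi> j))"
proof -
  let ?G = "gibbs_kernel \<pi> \<O>"
  let ?A = "?G ** kernel_power P t - stationary_projection \<pi>"
  have Pi: "stationary_projection \<pi> *v f = (\<Sum>x\<in>UNIV. \<pi> $ x * f $ x) *\<^sub>R 1" for f
    by (simp add: stationary_projection_def vec_eq_iff matrix_vector_mult_def)
  have "kernel_power P t *v 1 = 1"
    using kernel_power_eigenvector[of P "1" 1 t] markov_kernel_const[OF markov] by simp
  then have const: "?A *v 1 = 0"
    using distr by (simp add: matrix_vector_mult_diff_rdistrib matrix_vector_mul_assoc[symmetric]
        gibbs_kernel_const[OF distr partition] Pi positive_distribution_def)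
  have eig: "inner_pi \<pi> (?A *v \<phi> j) (?A *v \<phi> j) = \<eta> j ^ t * capture \<pi> \<O> (\<phi> j)"
    if j: "j \<in> {1..CARD('a) - 1}" for j
  proof -
    obtain l where l: "P *v \<phi> j = l *\<^sub>R \<phi> j" "\<eta> j = l\<^sup>2"
      using basis_eigenvalue[OF j] .
    have "?A *v \<phi> j = l ^ t *\<^sub>R (?G *v \<phi> j)"
      by (simp add: matrix_vector_mult_diff_rdistrib matrix_vector_mul_assoc[symmetric]
          kernel_power_eigenvector[OF l(1)] matrix_vector_mult_scaleR Pi basis_mean_zero[OF j])
    then show ?thesis
      by (simp add: inner_pi_scaleR_left inner_pi_scaleR_right capture_def l(2) power2_eq_square
          power_mult_distrib)
  qed
  have "horizon_error \<pi> P t \<O>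
      = (\<Sum>j=0..CARD('a) - 1. inner_pi \<pi> (?A *v (\<phi>(0 := 1)) j) (?A *v (\<phi>(0 := 1)) j))"
    unfolding horizon_error_def
    by (rule frobenius_sq_eq_sum_norms[OF distr spectral_basis_complete[OF distr basis]])
  also have "\<dots> = (\<Sum>j=1..CARD('a) - 1. inner_pi \<pi> (?A *v \<phi> j) (?A *v \<phi> j))"
    by (subst sum.atLeast_Suc_atMost) (auto simp: const inner_pi_zero_left intro!: sum.cong)
  also have "\<dots> = (\<Sum>j=1..CARD('a) - 1. \<eta> j ^ t * capture \<pi> \<O> (\<phi> j))"
    by (rule sum.cong[OF refl eig])
  finally show ?thesis .
qed

lemma finite_horizon_objective_eq:
  "finite_horizon_objective \<pi> P T w \<O>
     = (\<Sum>j=1..CARD('a) - 1. (\<Sum>t=1..T. w t * \<eta> j ^ t) * capture \<pi> \<O> (\<phi> j))"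
  unfolding finite_horizon_objective_def horizon_error_eq sum_distrib_left sum_distrib_right
  by (subst sum.swap) (simp add: mult_ac)

lemma discounted_objective_eq:
  assumes "0 \<le> \<gamma>" "\<gamma> < 1"
  shows "discounted_objective \<pi> P \<gamma> \<O>
     = (\<Sum>j=1..CARD('a) - 1. \<eta> j / (1 - \<gamma> * \<eta> j) * capture \<pi> \<O> (\<phi> j))"
proof -
  have "(\<lambda>t. \<gamma> ^ t * (\<eta> j ^ Suc t * capture \<pi> \<O> (\<phi> j)))
      sums (\<eta> j / (1 - \<gamma> * \<eta> j) * capture \<pi> \<O> (\<phi> j))" if j: "j \<in> {1..CARD('a) - 1}" for j
  proof -
    \<comment> \<open>\<open>eigenvalue_bounds\<close> admits \<open>\<eta> j = 1\<close>, so
      strictness comes from \<open>\<gamma> < 1\<close>.\<close>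
    have "\<gamma> * \<eta> j < 1" "0 \<le> \<gamma> * \<eta> j"
      using eigenvalue_bounds[OF j] assms mult_left_le[of "\<eta> j" \<gamma>] by auto
    then have "(\<lambda>t. (\<gamma> * \<eta> j) ^ t) sums (1 / (1 - \<gamma> * \<eta> j))"
      by (intro geometric_sums) simp
    from sums_mult[OF this, of "\<eta> j * capture \<pi> \<O> (\<phi> j)"] show ?thesis
      by (simp add: power_mult_distrib mult_ac)
  qed
  \<comment> \<open>Working with \<open>sums\<close> establishes convergence together with the
    value, so the infinite sum in the objective is a genuine limit.\<close>
  then have "(\<lambda>t. \<gamma> ^ t * horizon_error \<pi> P (Suc t) \<O>)
      sums (\<Sum>j=1..CARD('a) - 1. \<eta> j / (1 - \<gamma> * \<eta> j) * capture \<pi> \<O> (\<phi> j))"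
    unfolding horizon_error_eq sum_distrib_left by (rule sums_sum)
  then show ?thesis
    unfolding discounted_objective_def by (rule sums_unique[symmetric])
qed

end

lemma finite_horizon_weights_mono:
  assumes "\<forall>t\<in>{1..T}. 0 \<le> w t"
  shows "mono_on {1..CARD('a) - 1} (\<lambda>j. \<Sum>t=1..T. w t * \<eta> j ^ t)"
  using assms eigenvalue_mono eigenvalue_bounds
  by (auto simp: mono_on_def intro!: sum_mono mult_left_mono power_mono)

text \<open>As \<open>\<eta> j\<close> grows, the numerator grows and the positive denominator
  shrinks.\<close>

lemma discounted_weights_mono:
  assumes "0 \<le> \<gamma>" "\<gamma> < 1"
  shows "mono_on {1..CARD('a) - 1} (\<lambda>j. \<eta> j / (1 - \<gamma> * \<eta> j))"
proof (rule mono_onI)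
  fix i j assume ij: "i \<in> {1..CARD('a) - 1}" "j \<in> {1..CARD('a) - 1}" "i \<le> j"
  have "\<eta> i \<le> \<eta> j"
    using eigenvalue_mono ij by (auto simp: mono_on_def)
  moreover have "\<gamma> * \<eta> j < 1"
    using eigenvalue_bounds[OF ij(2)] assms mult_left_le[of "\<eta> j" \<gamma>] by auto
  ultimately show "\<eta> i / (1 - \<gamma> * \<eta> i) \<le> \<eta> j / (1 - \<gamma> * \<eta> j)"
    using eigenvalue_bounds[OF ij(1)] assms by (intro frac_le) (auto intro: mult_left_mono)
qed

end


section \<open>The sandwich bound\<close>

text \<open>The overview's exchange argument for plain sequences: the gain from \<open>k\<close> on
  and the loss below \<open>k\<close> are both bounded by extreme values of \<beta> times the same
  mass \<open>D\<close>.\<close>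

lemma weighted_mass_sandwich:
  fixes \<beta> a :: "nat \<Rightarrow> real"
  assumes mono: "mono_on {1..m} \<beta>" and k: "2 \<le> k" "k \<le> m"
    and a: "\<And>j. j \<in> {1..m} \<Longrightarrow> 0 \<le> a j" "\<And>j. j \<in> {1..m} \<Longrightarrow> a j \<le> 1"
    and total: "(\<Sum>j=1..m. a j) = real k - 1"
  defines "D \<equiv> \<Sum>j=1..k-1. 1 - a j"
  shows "(\<beta> k - \<beta> (k - 1)) * D \<le> (\<Sum>j=1..m. \<beta> j * a j) - (\<Sum>j=1..k-1. \<beta> j)"
    and "(\<Sum>j=1..m. \<beta> j * a j) - (\<Sum>j=1..k-1. \<beta> j) \<le> (\<beta> m - \<beta> 1) * D"
proof -
  have split: "(\<Sum>j=1..m. f j) = (\<Sum>j=1..k-1. f j) + (\<Sum>j=k..m. f j)" for f :: "nat \<Rightarrow> real"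
    using sum.ub_add_nat[of 1 "k - 1" f "m - (k - 1)"] k by simp
  have le: "\<beta> i \<le> \<beta> j" if "1 \<le> i" "i \<le> j" "j \<le> m" for i j
    using mono that by (auto simp: mono_on_def)
  \<comment> \<open>The total is \<open>k - 1\<close>, the number of indices below \<open>k\<close>,
    so the deficit there reappears as mass from \<open>k\<close> on.\<close>
  have upper: "(\<Sum>j=k..m. a j) = D"
    using total split[of a] k by (simp add: D_def sum_subtractf)
  have eq: "(\<Sum>j=1..m. \<beta> j * a j) - (\<Sum>j=1..k-1. \<beta> j)
      = (\<Sum>j=k..m. \<beta> j * a j) - (\<Sum>j=1..k-1. \<beta> j * (1 - a j))"
    unfolding split[of "\<lambda>j. \<beta> j * a j"] by (simp add: right_diff_distrib sum_subtractf)
  have "\<beta> k * D \<le> (\<Sum>j=k..m. \<beta> j * a j)" "(\<Sum>j=k..m. \<beta> j * a j) \<le> \<beta> m * D"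
    unfolding upper[symmetric] sum_distrib_left
    using k a by (auto intro!: sum_mono mult_right_mono le)
  moreover have "\<beta> 1 * D \<le> (\<Sum>j=1..k-1. \<beta> j * (1 - a j))"
      "(\<Sum>j=1..k-1. \<beta> j * (1 - a j)) \<le> \<beta> (k - 1) * D"
    unfolding D_def sum_distrib_left
    using k a by (auto intro!: sum_mono mult_right_mono le)
  ultimately show "(\<beta> k - \<beta> (k - 1)) * D \<le> (\<Sum>j=1..m. \<beta> j * a j) - (\<Sum>j=1..k-1. \<beta> j)"
    and "(\<Sum>j=1..m. \<beta> j * a j) - (\<Sum>j=1..k-1. \<beta> j) \<le> (\<beta> m - \<beta> 1) * D"
    unfolding eq by (auto simp: left_diff_distrib)
qed

text \<open>The third conjunct derives the inequality on the best candidate defect from a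
  \<rho>-approximate candidate, and the fourth takes that inequality as its premise. The assumption
  on \<open>sweep_output\<close> guarantees a candidate, so no minimum is over an empty set.\<close>

theorem corollary6p3:
  fixes P :: "real ^ 'a ^ 'a" and \<pi> :: "real ^ 'a"
    and \<eta> :: "nat \<Rightarrow> real" and \<phi> :: "nat \<Rightarrow> real ^ 'a"
    and k n :: nat
    and F :: "'a set set \<Rightarrow> real" and \<beta> :: "nat \<Rightarrow> real"
    and g W F_opt \<delta>_opt :: real and \<delta> :: "'a set set \<Rightarrow> real"
    and kmeans :: "('a, 'i) kmeans_procedure" and inits :: "'i list"
    and cands :: "'a set set list" and out :: "'a set set"
  assumes "n = CARD('a)" and "3 \<le> n" and "k \<in> {2..n - 1}"
    and "positive_distribution \<pi>"
    and "markov_kernel P" and "ergodic_kernel P" and "reversible_kernel \<pi> P"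
    and "spectral_basis \<pi> P \<eta> \<phi>"
    and "(\<exists>T w. 1 \<le> T \<and> (\<forall>t\<in>{1..T}. 0 \<le> w t) \<and> (\<exists>t\<in>{1..T}. w t \<noteq> 0) \<and>
            F = finite_horizon_objective \<pi> P T w \<and>
            (\<forall>j\<in>{1..n - 1}. \<beta> j = (\<Sum>t=1..T. w t * \<eta> j ^ t)))
         \<or> (\<exists>\<gamma>. 0 \<le> \<gamma> \<and> \<gamma> < 1 \<and>
            F = discounted_objective \<pi> P \<gamma> \<and>
            (\<forall>j\<in>{1..n - 1}. \<beta> j = \<eta> j / (1 - \<gamma> * \<eta> j)))"
    and "g = \<beta> k - \<beta> (k - 1)" and "W = \<beta> (n - 1) - \<beta> 1"
    and "\<delta> = spectral_defect \<pi> \<phi> k"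
    and "F_opt = (MIN \<O>\<in>k_partitions k. F \<O>)"
    and "\<delta>_opt = (MIN \<O>\<in>k_partitions k. \<delta> \<O>)"
    and "cands = sweep_candidates kmeans inits \<pi> \<phi> k"
    and "sweep_output F cands out"
  shows "0 \<le> F out - F_opt
       \<and> F out - F_opt \<le> W * (MIN \<O>\<in>set cands. \<delta> \<O>) - g * \<delta>_opt
       \<and> (\<forall>\<rho>. (\<exists>\<O>\<in>set cands. kmeans_approximation \<pi> (k - 1) (spectral_embedding \<phi> k) k \<rho> \<O>)
              \<longrightarrow> (MIN \<O>\<in>set cands. \<delta> \<O>) \<le> \<rho> * \<delta>_opt)
       \<and> (\<forall>\<rho>. (MIN \<O>\<in>set cands. \<delta> \<O>) \<le> \<rho> * \<delta>_opt
              \<longrightarrow> F out - F_opt \<le> (\<rho> * W - g) * \<delta>_opt)"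
proof -
  interpret spectral_setting \<pi> P \<eta> \<phi>
    using assms(4,5,8) by unfold_locales
  let ?K = "k_partitions k :: 'a set set set" and ?C = "set cands"
  let ?m = "CARD('a) - 1"
  \<comment> \<open>The ideal value: full capture below \<open>k\<close> and none from
    \<open>k\<close> on.\<close>
  define B where "B = (\<Sum>j=1..k-1. \<beta> j)"
  have m: "n - 1 = ?m" and k: "2 \<le> k" "k \<le> ?m" "k - 1 \<le> ?m"
    using assms(1,3) by auto
  \<comment> \<open>Both kinds of objective reduce to the same form here. \<beta> is prescribed only
    on the summation range, which is all that the congruence compares.\<close>
  have F: "F \<O> = (\<Sum>j=1..?m. \<beta> j * capture \<pi> \<O> (\<phi> j))" if "partition_on UNIV \<O>" for \<O>
    using assms(9) finite_horizon_objective_eq[OF that] discounted_objective_eq[OF that]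
    unfolding m by (auto intro!: sum.cong)
  have mono: "mono_on {1..?m} \<beta>"
    using assms(9) unfolding m
  proof (elim disjE exE conjE)
    fix T w
    assume "\<forall>t\<in>{1..T}. 0 \<le> w t" "\<forall>j\<in>{1..?m}. \<beta> j = (\<Sum>t=1..T. w t * \<eta> j ^ t)"
    then show ?thesis
      using finite_horizon_weights_mono[of T w] by (simp add: mono_on_def)
  next
    fix \<gamma> :: real
    assume "0 \<le> \<gamma>" "\<gamma> < 1" "\<forall>j\<in>{1..?m}. \<beta> j = \<eta> j / (1 - \<gamma> * \<eta> j)"
    then show ?thesis
      using discounted_weights_mono[of \<gamma>] by (simp add: mono_on_def)
  qed
  have g: "0 \<le> g" and W: "0 \<le> W"
    using mono k unfolding assms(10,11) m by (auto simp: mono_on_def)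
  have lower: "B + g * \<delta> \<O> \<le> F \<O>" and upper: "F \<O> \<le> B + W * \<delta> \<O>" if "\<O> \<in> ?K" for \<O>
  proof -
    have part: "partition_on UNIV \<O>" and card: "card \<O> = k"
      using that by (auto simp: k_partitions_def)
    have "(\<Sum>j=1..?m. capture \<pi> \<O> (\<phi> j)) = real k - 1"
      using sum_capture[OF part] card by simp
    note bounds = weighted_mass_sandwich[OF mono k(1,2) capture_bounds[OF part] this]
    show "B + g * \<delta> \<O> \<le> F \<O>" "F \<O> \<le> B + W * \<delta> \<O>"
      using bounds unfolding F[OF part] assms(10-12) m B_def spectral_defect_eq[OF part k(3)]
      by linarith+
  qed
  have best: "F out \<le> F \<O>" if "\<O> \<in> ?C" for \<O>
    using assms(16) that by (auto simp: sweep_output_def is_arg_min_linorder)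
  have out: "out \<in> ?C"
    using assms(16) by (auto simp: sweep_output_def is_arg_min_def)
  have sub: "?C \<subseteq> ?K"
    by (auto simp: assms(15) sweep_candidates_def)
  then have fin: "finite ?K" "?K \<noteq> {}" "?C \<noteq> {}"
    using out by auto
  have F_opt_le: "F_opt \<le> F out"
    unfolding assms(13) using out sub fin by auto
  have "F_opt \<in> F ` ?K"
    unfolding assms(13) using fin by (intro Min_in) auto
  then obtain \<O>' where \<O>': "\<O>' \<in> ?K" "F_opt = F \<O>'" by auto
  \<comment> \<open>The minimizer of \<open>F\<close> may differ from that of \<delta>; since
    \<open>0 \<le> g\<close>, this inequality still yields the lower bound with
    \<open>\<delta>_opt\<close>.\<close>
  have "\<delta>_opt \<le> \<delta> \<O>'"
    unfolding assms(14) using \<O>' fin by auto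
  then have lower_opt: "B + g * \<delta>_opt \<le> F_opt"
    using lower[OF \<O>'(1)] \<O>'(2) mult_left_mono[OF _ g, of \<delta>_opt "\<delta> \<O>'"] by linarith
  have "(MIN \<O>\<in>?C. \<delta> \<O>) \<in> \<delta> ` ?C"
    using fin by (intro Min_in) auto
  then obtain \<O>s where \<O>s: "\<O>s \<in> ?C" "(MIN \<O>\<in>?C. \<delta> \<O>) = \<delta> \<O>s" by auto
  \<comment> \<open>The output is compared with the candidate of least defect: rescoring gives
    \<open>F out \<le> F \<O>s\<close>, the upper sandwich bounds the latter, and \<open>B\<close>
    cancels.\<close>
  have main: "F out - F_opt \<le> W * (MIN \<O>\<in>?C. \<delta> \<O>) - g * \<delta>_opt"
    using upper[of \<O>s] best[OF \<O>s(1)] \<O>s sub lower_opt by auto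
  have distortion: "kmeans_distortion \<pi> (k - 1) (spectral_embedding \<phi> k) \<O> = \<delta> \<O>"
    if "\<O> \<in> ?K" for \<O>
    using that kmeans_distortion_eq_spectral_defect[OF distr]
    by (simp add: k_partitions_def assms(12))
  have approx: "(MIN \<O>\<in>?C. \<delta> \<O>) \<le> \<rho> * \<delta>_opt"
    if "\<O> \<in> ?C" "kmeans_approximation \<pi> (k - 1) (spectral_embedding \<phi> k) k \<rho> \<O>" for \<rho> \<O>
  proof -
    have "\<delta> \<O> \<le> \<rho> * \<delta>_opt"
      \<comment> \<open>Distortion and \<delta> agree on all \<open>k\<close>-block partitions, so
        their images, and hence their minima, coincide.\<close>
      using that sub distortion[of \<O>] image_cong[OF refl distortion, of ?K]
      by (auto simp: kmeans_approximation_def assms(14))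
    moreover have "(MIN \<O>\<in>?C. \<delta> \<O>) \<le> \<delta> \<O>"
      using that by auto
    ultimately show ?thesis by linarith
  qed
  have "F out - F_opt \<le> (\<rho> * W - g) * \<delta>_opt" if "(MIN \<O>\<in>?C. \<delta> \<O>) \<le> \<rho> * \<delta>_opt" for \<rho>
    using main mult_left_mono[OF that W] by (simp add: algebra_simps)
  then show ?thesis
    using F_opt_le main approx by auto
qed

end
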